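(* Define $$k_{max1}=-1+\min\{N,M,N+2-N',M+2-M'\},\qquad k_{mn}=M+N-1+\min\{0,\,2-N',\,2-M',\,4-M'-N'\},$$ $k_{max2}=\min\{k_{max1},k_{mn}\}$, and the bilinear expressions $$f_k=\sum_{i=0}^{k}\operatorname{Tr}(u_iv_{k-i}),\qquad \tilde f_k=\sum_{i=0}^{k}\operatorname{Tr}(\tilde u_i\tilde v_{k-i}).$$ Then $f_k$ for $k=0,\dots,k_{max2}$ are preserved by the Darboux transformation, i.e. $\tilde f_k=f_k$, provided that $\det T_0\ne0$.
   Context: $x=(x^1,x^2)$; $,_1,,_2$ denote derivatives with respect to $x^1,x^2$, taking into account the possible dependence of the spectral parameter $\lambda$ on $x$. The linear problem $\Psi,_1=U\Psi$, $\Psi,_2=V\Psi$ has $n\times n$ matrices $$U=\sum_{k=0}^\infty u_k\lambda^{N-k},\qquad V=\sum_{k=0}^\infty v_k\lambda^{M-k},$$ for $\lambda$ near $\infty$, with $N,M$ fixed positive integers and $u_k=u_k(x)$, $v_k=v_k(x)$ (usually only finitely many are nonzero). The spectral parameter satisfies $$\lambda,_1=\sum_{k=0}^\infty a_k\lambda^{N'-k},\qquad \lambda,_2=\sum_{k=0}^\infty b_k\lambda^{M'-k},$$ with scalar $a_k=a_k(x)$, $b_k=b_k(x)$ and given integers $N',M'$ (in the nonisospectral case fixed by requiring $a_0\ne0$, $b_0\ne0$; the isospectral case is $\lambda,_1=\lambda,_2=0$). A Darboux transformation replaces $U,V$ by $$\tilde U=D,_1D^{-1}+DUD^{-1},\qquad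 \tilde V=D,_2D^{-1}+DVD^{-1},$$ where the Darboux matrix $D$ is analytic at $\lambda=\infty$, $D=T_0+T_1\lambda^{-1}+T_2\lambda^{-2}+\dots$ with $T_k=T_k(x)$, and is such that $\tilde U,\tilde V$ are of the same form as $U,V$: $\tilde U=\sum_{k\ge0}\tilde u_k\lambda^{N-k}$, $\tilde V=\sum_{k\ge0}\tilde v_k\lambda^{M-k}$. *)

theory Defs
  imports "HOL-Analysis.Analysis"
begin

type_synonym point = "real \<times> real"

definition expands_at_infinity :: "(complex \<Rightarrow> complex) \<Rightarrow> int \<Rightarrow> (nat \<Rightarrow> complex) \<Rightarrow> bool" where
  "expands_at_infinity F p c \<longleftrightarrow>
     (\<forall>\<^sub>F z in at_infinity. (\<lambda>k. c k * z powi (p - int k)) sums F z)"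

definition matrix_expands_at_infinity ::
  "(complex \<Rightarrow> complex^'n^'n) \<Rightarrow> int \<Rightarrow> (nat \<Rightarrow> complex^'n^'n) \<Rightarrow> bool" where
  "matrix_expands_at_infinity F p C \<longleftrightarrow>
     (\<forall>i j. expands_at_infinity (\<lambda>z. F z $ i $ j) p (\<lambda>k. C k $ i $ j))"

definition continuously_differentiable_on ::
  "('a::euclidean_space \<Rightarrow> 'b::euclidean_space) \<Rightarrow> 'a set \<Rightarrow> bool" where
  "continuously_differentiable_on f W \<longleftrightarrow>
     (\<forall>p\<in>W. f differentiable (at p)) \<and>
     (\<forall>v. continuous_on W (\<lambda>p. frechet_derivative f (at p) v))"

text \<open>
  Analyticity at infinity of a matrix depending on a point: near every point the expansion in
  nonpositive powers of the spectral parameter converges on a neighbourhood of infinity that does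
  not depend on the point.  Joint continuous differentiability is the regularity needed for the
  derivatives of the Darboux matrix to make sense and to be computable term by term; the
  coefficients \<open>T k\<close> are then differentiable as well.
\<close>

definition analytic_at_infinity_on ::
  "point set \<Rightarrow> (point \<Rightarrow> complex \<Rightarrow> complex^'n^'n) \<Rightarrow> (nat \<Rightarrow> point \<Rightarrow> complex^'n^'n) \<Rightarrow> bool" where
  "analytic_at_infinity_on \<Omega> D T \<longleftrightarrow>
     (\<forall>x\<in>\<Omega>. \<exists>S R. open S \<and> x \<in> S \<and> S \<subseteq> \<Omega> \<and> R > 0 \<and>
        (\<forall>y\<in>S. \<forall>z. R < norm z \<longrightarrow>
           (\<forall>i j. (\<lambda>k. T k y $ i $ j * z powi (- int k)) sums (D y z $ i $ j))) \<and>
        continuously_differentiable_on (\<lambda>(y, z). D y z) (S \<times> {z. R < norm z}))"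

text \<open>
  The derivative in the coordinate direction \<open>e\<close>, with the spectral parameter itself depending on
  the point: if \<open>L x z\<close> is the derivative of the spectral parameter in the direction \<open>e\<close> when it
  has the value \<open>z\<close> at \<open>x\<close>, the chain rule gives the derivative of \<open>F\<close> in the direction
  \<open>(e, L x z)\<close>.
\<close>

definition total_derivative ::
  "point \<Rightarrow> (point \<Rightarrow> complex \<Rightarrow> complex) \<Rightarrow> (point \<Rightarrow> complex \<Rightarrow> 'b::real_normed_vector)
     \<Rightarrow> point \<Rightarrow> complex \<Rightarrow> 'b" where
  "total_derivative e L F x z = frechet_derivative (\<lambda>(y, w). F y w) (at (x, z)) (e, L x z)"

definition darboux_transform ::
  "point \<Rightarrow> (point \<Rightarrow> complex \<Rightarrow> complex) \<Rightarrow> (point \<Rightarrow> complex \<Rightarrow> complex^'n^'n)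
     \<Rightarrow> (point \<Rightarrow> complex \<Rightarrow> complex^'n^'n) \<Rightarrow> point \<Rightarrow> complex \<Rightarrow> complex^'n^'n" where
  "darboux_transform e L D U x z =
     total_derivative e L D x z ** matrix_inv (D x z) + D x z ** U x z ** matrix_inv (D x z)"

definition bilinear_form ::
  "(nat \<Rightarrow> point \<Rightarrow> complex^'n^'n) \<Rightarrow> (nat \<Rightarrow> point \<Rightarrow> complex^'n^'n) \<Rightarrow> nat \<Rightarrow> point \<Rightarrow> complex" where
  "bilinear_form u v k x = (\<Sum>i=0..k. trace (u i x ** v (k - i) x))"

definition k_max1 :: "int \<Rightarrow> int \<Rightarrow> int \<Rightarrow> int \<Rightarrow> int" where
  "k_max1 N M N' M' = -1 + Min {N, M, N + 2 - N', M + 2 - M'}"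

definition k_mn :: "int \<Rightarrow> int \<Rightarrow> int \<Rightarrow> int \<Rightarrow> int" where
  "k_mn N M N' M' = M + N - 1 + Min {0, 2 - N', 2 - M', 4 - M' - N'}"

definition k_max2 :: "int \<Rightarrow> int \<Rightarrow> int \<Rightarrow> int \<Rightarrow> int" where
  "k_max2 N M N' M' = min (k_max1 N M N' M') (k_mn N M N' M')"

end

theory Submission
  imports Defs "HOL-Complex_Analysis.Conformal_Mappings" "HOL-Library.Landau_Symbols"
begin

text \<open>
  Write \<open>W\<close> for \<open>D\<inverse>\<close> and \<open>X\<close>, \<open>Y\<close> for the two derivatives of \<open>D\<close>.  The numbers \<open>f\<^sub>k\<close> are the
  expansion coefficients of \<open>Tr (U V)\<close> at infinity, and by cyclicity of the trace the Darboux
  transformation changes \<open>Tr (U V)\<close> by \<open>Tr (X V W) + Tr (U W Y) + Tr (X W Y W)\<close>.  As \<open>det T\<^sub>0 \<noteq> 0\<close>,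
  \<open>W\<close> is bounded near infinity; the derivative of \<open>D\<close> in the spectral parameter is of order \<open>-2\<close>,
  so \<open>X\<close> and \<open>Y\<close> have orders \<open>max 0 (N' - 2)\<close> and \<open>max 0 (M' - 2)\<close>.  Hence the change only affects
  coefficients with index beyond \<open>k_max2\<close>.
\<close>

section \<open>Expansions in descending powers at infinity and growth orders\<close>

lemma expands_at_infinity_powser:
  assumes "expands_at_infinity F p c"
  obtains g s where "s > 0" "\<And>w. norm w < s \<Longrightarrow> (\<lambda>k. c k * w ^ k) sums g w"
    and "\<forall>\<^sub>F z in at_infinity. z \<noteq> 0 \<and> norm (inverse z) < s \<and> F z = z powi p * g (inverse z)"
proof -
  obtain B where B: "\<And>z. norm z \<ge> B \<Longrightarrow> (\<lambda>k. c k * z powi (p - int k)) sums F z"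
    using assms unfolding expands_at_infinity_def eventually_at_infinity by blast
  \<comment> \<open>The maximum with 1 keeps \<open>B'\<close> positive, so that
    \<open>inverse B'\<close> can serve as a radius and \<open>z\<close> is nonzero beyond
    it.\<close>
  define B' where "B' = max B 1"
  have B': "B' \<ge> B" "B' > 0" by (auto simp: B'_def)
  define g where "g w = (\<Sum>k. c k * w ^ k)" for w
  have key: "(\<lambda>k. c k * inverse z ^ k) sums (F z / z powi p)" if "norm z \<ge> B'" for z
  proof -
    have "z \<noteq> 0" using that B' by auto
    then have "z powi (p - int k) = z powi p * inverse z ^ k" for k
      by (simp add: power_int_diff power_inverse field_simps)
    then have "(\<lambda>k. z powi p * (c k * inverse z ^ k)) sums F z"
      using B[of z] that B' by (simp add: mult.left_commute)
    from sums_divide[OF this, of "z powi p"] \<open>z \<noteq> 0\<close> show ?thesis by simp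
  qed
  have g: "(\<lambda>k. c k * w ^ k) sums g w" if "norm w < inverse B'" for w
  \<comment> \<open>The point \<open>w = 0\<close> stands for infinity and is not
    \<open>inverse z\<close> for a large \<open>z\<close>, so convergence there has to be seen
    separately.\<close>
  proof (cases "w = 0")
    case True
    have "(\<lambda>k. c k * w ^ k) sums c 0" using True powser_sums_zero[of c] by simp
    then show ?thesis unfolding g_def by (rule sums_summable[THEN summable_sums])
  next
    case False
    then have "norm (inverse w) \<ge> B'"
      using that B' by (simp add: norm_inverse) (metis inverse_inverse_eq le_imp_inverse_le less_imp_le zero_less_norm_iff)
    from key[OF this] show ?thesis unfolding g_def by (simp add: sums_summable summable_sums)
  qed
  have ev: "\<forall>\<^sub>F z in at_infinity. z \<noteq> 0 \<and> norm (inverse z) < inverse B' \<and> F z = z powi p * g (inverse z)"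
    unfolding eventually_at_infinity
  \<comment> \<open>The extra 1 makes \<open>norm (inverse z) < inverse B'\<close> strict, as the
    open disc requires.\<close>
  proof (intro exI[of _ "B' + 1"] allI impI)
    fix z :: complex assume z: "B' + 1 \<le> norm z"
    then have nz: "z \<noteq> 0" using B' by auto
    have lt: "norm (inverse z) < inverse B'" using z B' by (auto simp: norm_inverse intro!: less_imp_inverse_less)
    have "g (inverse z) = F z / z powi p"
      using sums_unique2[OF g[OF lt] key] z by simp
    with nz lt show "z \<noteq> 0 \<and> norm (inverse z) < inverse B' \<and> F z = z powi p * g (inverse z)" by simp
  qed
  show thesis by (rule that[OF _ g ev]) (use B' in auto)
qed

text \<open>After division by \<open>z powi p\<close> a power series in \<open>inverse z\<close>
  remains, and it is continuous at 0. The limit serves twice: it bounds the order of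
  \<open>F\<close>, and by uniqueness of limits it detects when \<open>c 0\<close> vanishes.\<close>

lemma expands_at_infinity_lead:
  assumes "expands_at_infinity F p c"
  shows "((\<lambda>z. F z / z powi p) \<longlongrightarrow> c 0) at_infinity"
proof -
  obtain g s where s: "s > 0" "\<And>w. norm w < s \<Longrightarrow> (\<lambda>k. c k * w ^ k) sums g w"
    and ev: "\<forall>\<^sub>F z in at_infinity. z \<noteq> 0 \<and> norm (inverse z) < s \<and> F z = z powi p * g (inverse z)"
    using expands_at_infinity_powser[OF assms] by blast
  have "(g \<longlongrightarrow> c 0) (at 0)" by (rule powser_limit_0[OF s])
  then have "((\<lambda>z. g (inverse z)) \<longlongrightarrow> c 0) at_infinity"
    by (simp add: lim_at_infinity_0 o_def)
  then show ?thesis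
    by (rule Lim_transform_eventually) (use ev in \<open>auto elim!: eventually_mono\<close>)
qed

lemma eventually_nonzero_at_infinity: "\<forall>\<^sub>F z::complex in at_infinity. z \<noteq> 0"
  unfolding eventually_at_infinity by (rule exI[of _ 1]) auto

lemma eventually_powi_nonzero_at_infinity: "\<forall>\<^sub>F z::complex in at_infinity. z powi p \<noteq> 0"
  using eventually_nonzero_at_infinity by (rule eventually_mono) simp

lemma bigo_transform_eventually:
  "f \<in> O[F](h) \<Longrightarrow> \<forall>\<^sub>F x in F. f x = g x \<Longrightarrow> g \<in> O[F](h)"
  using landau_o.big.in_cong[of f g F h] by simp

lemma expands_at_infinity_bigo:
  assumes "expands_at_infinity F p c"
  shows "F \<in> O[at_infinity](\<lambda>z. z powi p)"
  by (rule bigoI_tendsto[OF expands_at_infinity_lead[OF assms]])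
     (rule eventually_powi_nonzero_at_infinity)

lemma powi_bigo_mono:
  assumes "p \<le> q"
  shows "(\<lambda>z::complex. z powi p) \<in> O[at_infinity](\<lambda>z. z powi q)"
proof (rule bigoI[of _ 1])
  show "\<forall>\<^sub>F z::complex in at_infinity. norm (z powi p) \<le> 1 * norm (z powi q)"
    unfolding eventually_at_infinity
    by (rule exI[of _ 1]) (auto simp: norm_power_int intro!: power_int_increasing assms)
qed

lemma bigo_powi_mono:
  fixes F :: "complex \<Rightarrow> complex"
  assumes "F \<in> O[at_infinity](\<lambda>z. z powi p)" "p \<le> q"
  shows "F \<in> O[at_infinity](\<lambda>z. z powi q)"
  using landau_o.big_trans[OF assms(1) powi_bigo_mono[OF assms(2)]] .

lemma bigo_powi_mult:
  fixes F G :: "complex \<Rightarrow> complex"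
  assumes "F \<in> O[at_infinity](\<lambda>z. z powi p)" "G \<in> O[at_infinity](\<lambda>z. z powi q)"
  shows "(\<lambda>z. F z * G z) \<in> O[at_infinity](\<lambda>z. z powi (p + q))"
proof -
  have "(\<lambda>z. F z * G z) \<in> O[at_infinity](\<lambda>z. z powi p * z powi q)"
    by (rule landau_o.big.mult[OF assms])
  also have "(\<lambda>z::complex. z powi p * z powi q) \<in> O[at_infinity](\<lambda>z. z powi (p + q))"
    by (rule bigoI[of _ 1])
       (use eventually_nonzero_at_infinity in \<open>auto elim!: eventually_mono simp: power_int_add\<close>)
  finally show ?thesis .
qed

lemma expands_at_infinity_sum:
  assumes "\<And>i. i \<in> I \<Longrightarrow> expands_at_infinity (F i) p (c i)" "finite I"
  shows "expands_at_infinity (\<lambda>z. \<Sum>i\<in>I. F i z) p (\<lambda>k. \<Sum>i\<in>I. c i k)"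
proof -
  have "\<forall>\<^sub>F z in at_infinity. \<forall>i\<in>I. (\<lambda>k. c i k * z powi (p - int k)) sums F i z"
    using assms by (auto simp: eventually_ball_finite_distrib expands_at_infinity_def)
  then show ?thesis unfolding expands_at_infinity_def
    by eventually_elim (auto simp: sum_distrib_right intro!: sums_sum)
qed

lemma expands_at_infinity_diff:
  assumes "expands_at_infinity F p c" "expands_at_infinity G p d"
  shows "expands_at_infinity (\<lambda>z. F z - G z) p (\<lambda>k. c k - d k)"
  using assms unfolding expands_at_infinity_def
  by eventually_elim (auto simp: left_diff_distrib intro!: sums_diff)

text \<open>In the variable \<open>inverse z\<close> this is the Cauchy product of two power series,
  which converge absolutely inside their discs.\<close>

lemma expands_at_infinity_mult:
  assumes "expands_at_infinity F p c" "expands_at_infinity G q d"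
  shows "expands_at_infinity (\<lambda>z. F z * G z) (p + q) (\<lambda>k. \<Sum>i\<le>k. c i * d (k - i))"
proof -
  obtain f s where s: "s > 0" "\<And>w. norm w < s \<Longrightarrow> (\<lambda>k. c k * w ^ k) sums f w"
    and evF: "\<forall>\<^sub>F z in at_infinity. z \<noteq> 0 \<and> norm (inverse z) < s \<and> F z = z powi p * f (inverse z)"
    using expands_at_infinity_powser[OF assms(1)] by blast
  obtain g t where t: "t > 0" "\<And>w. norm w < t \<Longrightarrow> (\<lambda>k. d k * w ^ k) sums g w"
    and evG: "\<forall>\<^sub>F z in at_infinity. z \<noteq> 0 \<and> norm (inverse z) < t \<and> G z = z powi q * g (inverse z)"
    using expands_at_infinity_powser[OF assms(2)] by blast
  \<comment> \<open>Convergence at a real point \<open>r'\<close> strictly between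
    \<open>norm w\<close> and \<open>r\<close> forces absolute convergence at
    \<open>w\<close>.\<close>
  have abs_summable: "summable (\<lambda>k. norm (e k * w ^ k))"
    if e: "\<And>w. norm w < r \<Longrightarrow> (\<lambda>k. e k * w ^ k) sums h w" and w: "norm w < r"
    for e :: "nat \<Rightarrow> complex" and h r w
  proof -
    obtain r' where r': "norm w < r'" "r' < r" using w dense by blast
    then have pos: "0 < r'" using norm_ge_zero[of w] by linarith
    show ?thesis
      by (rule powser_insidea[of e "of_real r'"])
         (use r' pos e[of "of_real r'"] in \<open>auto simp: sums_iff\<close>)
  qed
  show ?thesis unfolding expands_at_infinity_def using evF evG
  proof eventually_elim
    case (elim z)
    let ?w = "inverse z"
    have "(\<lambda>k. \<Sum>i\<le>k. (c i * ?w ^ i) * (d (k - i) * ?w ^ (k - i))) sums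
        ((\<Sum>k. c k * ?w ^ k) * (\<Sum>k. d k * ?w ^ k))"
      by (rule Cauchy_product_sums) (use elim abs_summable[OF s(2)] abs_summable[OF t(2)] in auto)
    also have "(\<Sum>k. c k * ?w ^ k) = f ?w" using s(2)[of ?w] elim by (simp add: sums_iff)
    also have "(\<Sum>k. d k * ?w ^ k) = g ?w" using t(2)[of ?w] elim by (simp add: sums_iff)
    finally have "(\<lambda>k. z powi (p + q) * (\<Sum>i\<le>k. (c i * ?w ^ i) * (d (k - i) * ?w ^ (k - i)))) sums
        (z powi (p + q) * (f ?w * g ?w))" by (rule sums_mult)
    also have "z powi (p + q) * (f ?w * g ?w) = F z * G z"
      using elim by (simp add: power_int_add)
    also have "(\<lambda>k. z powi (p + q) * (\<Sum>i\<le>k. (c i * ?w ^ i) * (d (k - i) * ?w ^ (k - i)))) =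
        (\<lambda>k. (\<Sum>i\<le>k. c i * d (k - i)) * z powi (p + q - int k))"
    proof
      fix k
      have "(\<Sum>i\<le>k. (c i * ?w ^ i) * (d (k - i) * ?w ^ (k - i))) = (\<Sum>i\<le>k. c i * d (k - i) * ?w ^ k)"
        by (rule sum.cong) (auto simp: mult_ac simp flip: power_add)
      also have "\<dots> = (\<Sum>i\<le>k. c i * d (k - i)) * ?w ^ k" by (simp add: sum_distrib_right)
      finally show "z powi (p + q) * (\<Sum>i\<le>k. (c i * ?w ^ i) * (d (k - i) * ?w ^ (k - i))) =
          (\<Sum>i\<le>k. c i * d (k - i)) * z powi (p + q - int k)"
        using elim by (simp add: power_int_diff power_inverse field_simps)
    qed
    finally show ?case .
  qed
qed

lemma expands_at_infinity_shift:
  assumes "expands_at_infinity F p c" "c 0 = 0"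
  shows "expands_at_infinity F (p - 1) (\<lambda>k. c (Suc k))"
  using assms(1) unfolding expands_at_infinity_def
proof eventually_elim
  case (elim z)
  have "(\<lambda>k. c (Suc k) * z powi (p - int (Suc k))) sums F z"
    using elim assms(2) by (subst sums_Suc_iff) simp
  then show ?case by (simp add: algebra_simps)
qed

text \<open>Orders are integers, so \<open>q < p\<close> makes \<open>F z / z powi p\<close> of
  order \<open>inverse z\<close>. It tends to 0, while its limit is also \<open>c 0\<close>.\<close>

lemma expands_at_infinity_lead_zero:
  assumes "expands_at_infinity F p c" "F \<in> O[at_infinity](\<lambda>z. z powi q)" "q < p"
  shows "c 0 = 0"
proof -
  have "F \<in> O[at_infinity](\<lambda>z. z powi (p - 1))"
    by (rule bigo_powi_mono[OF assms(2)]) (use assms(3) in auto)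
  then have "(\<lambda>z. F z / z powi p) \<in> O[at_infinity](\<lambda>z. z powi (p - 1) / z powi p)"
    by (intro landau_o.big.divide_right eventually_powi_nonzero_at_infinity)
  also have "(\<lambda>z::complex. z powi (p - 1) / z powi p) \<in> O[at_infinity](\<lambda>z. inverse z)"
    by (rule bigoI[of _ 1])
       (use eventually_nonzero_at_infinity in \<open>auto elim!: eventually_mono simp: power_int_diff norm_divide field_simps\<close>)
  also have "(\<lambda>z::complex. inverse z) \<in> o[at_infinity](\<lambda>_. 1)"
    by (rule smalloI_tendsto) (auto intro: tendsto_inverse_0)
  finally have "((\<lambda>z. F z / z powi p) \<longlongrightarrow> 0) at_infinity"
    by (auto dest: smalloD_tendsto)
  from tendsto_unique[OF trivial_limit_at_infinity expands_at_infinity_lead[OF assms(1)] this]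
  show ?thesis .
qed

text \<open>This turns a growth bound into information on coefficients. They are stripped off one at
  a time: once the leading one vanishes, the shifted series has order \<open>p - 1\<close> and the
  gap to \<open>q\<close> shrinks by one.\<close>

lemma expands_at_infinity_coeff_zero:
  assumes "expands_at_infinity F p c" "F \<in> O[at_infinity](\<lambda>z. z powi q)" "q < p - int k"
  shows "c k = 0"
  using assms
proof (induction k arbitrary: p c)
  case (0 p c)
  then show ?case by (auto intro: expands_at_infinity_lead_zero)
next
  case (Suc k p c)
  have "c 0 = 0"
    by (rule expands_at_infinity_lead_zero[OF Suc.prems(1,2)]) (use Suc.prems(3) in auto)
  from Suc.IH[OF expands_at_infinity_shift[OF Suc.prems(1) this] Suc.prems(2)] Suc.prems(3)
  show ?case by auto
qed

section \<open>Series in nonpositive powers outside a disc, and bounds on their derivatives\<close>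

lemma exterior_powser_holomorphic:
  fixes f :: "complex \<Rightarrow> complex"
  assumes "R > 0" "\<And>z. R < norm z \<Longrightarrow> (\<lambda>k. c k * z powi (- int k)) sums f z"
  obtains g where "g holomorphic_on ball 0 (inverse R)" "\<And>z. R < norm z \<Longrightarrow> f z = g (inverse z)"
proof
  define g where "g w = (\<Sum>k. c k * w ^ k)" for w
  have f: "(\<lambda>k. c k * inverse z ^ k) sums f z" if "R < norm z" for z
    using assms(2)[OF that] by (simp add: power_int_minus power_inverse)
  show "g holomorphic_on ball 0 (inverse R)"
  proof (rule power_series_holomorphic)
    fix w :: complex assume w: "w \<in> ball 0 (inverse R)"
    have "summable (\<lambda>k. c k * w ^ k)"
    proof (cases "w = 0")
      case True
      then show ?thesis using powser_sums_zero[of c] by (simp add: sums_iff)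
    next
      case False
      then have "R < norm (inverse w)"
        using w assms(1) by (simp add: norm_inverse) (metis inverse_inverse_eq less_imp_inverse_less zero_less_norm_iff)
      from f[OF this] show ?thesis by (simp add: sums_iff)
    qed
    then show "(\<lambda>k. c k * (w - 0) ^ k) sums g w" by (simp add: g_def summable_sums)
  qed
  show "f z = g (inverse z)" if "R < norm z" for z
    using f[OF that] by (simp add: g_def sums_iff)
qed

text \<open>Inversion maps the exterior of the circle, together with infinity, to a closed disc.
  Without positive powers there is no pole at infinity, so the usual maximum principle applies to
  \<open>g\<close> on that disc.\<close>

lemma maximum_modulus_exterior:
  fixes f :: "complex \<Rightarrow> complex"
  assumes "R > 0" "\<And>z. R < norm z \<Longrightarrow> (\<lambda>k. c k * z powi (- int k)) sums f z"
    and "R < r" and B: "\<And>z. norm z = r \<Longrightarrow> norm (f z) \<le> B" and z: "norm z \<ge> r"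
  shows "norm (f z) \<le> B"
proof -
  obtain g where g: "g holomorphic_on ball 0 (inverse R)" "\<And>z. R < norm z \<Longrightarrow> f z = g (inverse z)"
    using exterior_powser_holomorphic[OF assms(1,2)] by blast
  have sub: "cball 0 (inverse r) \<subseteq> ball (0::complex) (inverse R)"
    using less_imp_inverse_less[OF assms(3,1)] by auto
  have "norm (g (inverse z)) \<le> B"
  proof (rule maximum_modulus_frontier[of g "cball 0 (inverse r)"])
    show "g holomorphic_on interior (cball 0 (inverse r))"
      using g(1) sub interior_subset by (blast intro: holomorphic_on_subset)
    show "continuous_on (closure (cball 0 (inverse r))) g"
      using g(1) sub by (auto intro: holomorphic_on_subset holomorphic_on_imp_continuous_on)
    show "norm (g w) \<le> B" if "w \<in> frontier (cball 0 (inverse r))" for w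
    proof -
      have w: "norm (inverse w) = r" using that assms by (simp add: norm_inverse)
      have "g w = f (inverse w)" using g(2)[of "inverse w"] w assms(3) by simp
      with B[OF w] show ?thesis by simp
    qed
    show "inverse z \<in> cball 0 (inverse r)"
      using z assms(1,3) by (simp add: norm_inverse le_imp_inverse_le)
  qed simp
  with g(2)[of z] z assms(3) show ?thesis by simp
qed

text \<open>Carries a bound from difference quotients, for which the maximum principle is available,
  back to the derivative in the limit.\<close>

lemma has_vector_derivative_norm_le:
  assumes "(\<phi> has_vector_derivative D) (at 0)"
    and "\<forall>\<^sub>F t in at 0. norm (\<phi> t - \<phi> 0) \<le> C * \<bar>t\<bar>"
  shows "norm D \<le> C"
proof -
  have "((\<lambda>t. norm (\<phi> t - \<phi> 0 - t *\<^sub>R D) / norm t) \<longlongrightarrow> 0) (at 0)"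
    using assms(1) by (simp add: has_vector_derivative_def has_derivative_at)
  then have "((\<lambda>t. C + norm (\<phi> t - \<phi> 0 - t *\<^sub>R D) / norm t) \<longlongrightarrow> C + 0) (at 0)"
    by (intro tendsto_intros)
  moreover have "\<forall>\<^sub>F t in at 0. norm D \<le> C + norm (\<phi> t - \<phi> 0 - t *\<^sub>R D) / norm t"
    using assms(2) eventually_neq_at_within[of 0 0 UNIV]
  proof eventually_elim
    case (elim t)
    have "\<bar>t\<bar> * norm D = norm ((\<phi> t - \<phi> 0) - (\<phi> t - \<phi> 0 - t *\<^sub>R D))" by simp
    also have "\<dots> \<le> C * \<bar>t\<bar> + norm (\<phi> t - \<phi> 0 - t *\<^sub>R D)"
      using norm_triangle_ineq4[of "\<phi> t - \<phi> 0" "\<phi> t - \<phi> 0 - t *\<^sub>R D"] elim by linarith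
    finally show ?case using elim by (simp add: field_simps)
  qed
  ultimately have "norm D \<le> C + 0" by (intro tendsto_lowerbound) auto
  then show ?thesis by simp
qed

text \<open>
  Difference quotients in the parameter are again series in nonpositive powers, so by the maximum
  principle they are bounded by their values on one circle, where joint continuous
  differentiability applies; no derivative of a coefficient enters.
\<close>

lemma parameter_derivative_bounded:
  fixes h :: "point \<Rightarrow> complex \<Rightarrow> complex"
  assumes S: "open S" "x \<in> S" "R > 0"
    and sums: "\<And>y z. y \<in> S \<Longrightarrow> R < norm z \<Longrightarrow> (\<lambda>k. t k y * z powi (- int k)) sums h y z"
    and der: "\<And>y z. y \<in> S \<Longrightarrow> R < norm z \<Longrightarrow> ((\<lambda>(y, z). h y z) has_derivative A (y, z)) (at (y, z))"
    and cont: "continuous_on (S \<times> {z. R < norm z}) (\<lambda>p. A p (e, 0))"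
  shows "(\<lambda>z. A (x, z) (e, 0)) \<in> O[at_infinity](\<lambda>_. 1)"
proof -
  obtain \<delta> where \<delta>: "\<delta> > 0" "cball x \<delta> \<subseteq> S" using S open_contains_cball by blast
  \<comment> \<open>Any radius beyond \<open>R\<close> would do: the circle must lie inside the
    region of continuous differentiability, so that \<open>K\<close> is a compact subset of
    it.\<close>
  define R' where "R' = R + 1"
  have R': "R < R'" "R' > 0" using S by (auto simp: R'_def)
  define K where "K = cball x \<delta> \<times> sphere (0::complex) R'"
  have KS: "K \<subseteq> S \<times> {z. R < norm z}" using \<delta> R' by (auto simp: K_def)
  have "compact K" unfolding K_def by (intro compact_Times) auto
  then have "bounded ((\<lambda>p. A p (e, 0)) ` K)"
    using continuous_on_subset[OF cont KS] compact_continuous_image compact_imp_bounded by blast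
  then obtain C where C: "\<And>p. p \<in> K \<Longrightarrow> norm (A p (e, 0)) \<le> C"
    by (auto simp: bounded_iff)
  \<comment> \<open>Steps up to \<open>r\<close> along \<open>e\<close> stay within distance
    \<open>\<delta>\<close> of \<open>x\<close>; the added 1 covers \<open>e = 0\<close>.\<close>
  define r where "r = \<delta> / (norm e + 1)"
  have r: "r > 0" using \<delta> by (simp add: r_def add_nonneg_pos)
  have seg: "x + s *\<^sub>R e \<in> cball x \<delta>" if "\<bar>s\<bar> \<le> r" for s
  proof -
    have "\<bar>s\<bar> * norm e \<le> r * (norm e + 1)" using that r by (intro mult_mono) auto
    also have "\<dots> = \<delta>" by (simp add: r_def add_nonneg_eq_0_iff)
    finally show ?thesis by (simp add: dist_norm)
  qed
  have vd: "((\<lambda>s. h (x + s *\<^sub>R e) z) has_vector_derivative A (x + s *\<^sub>R e, z) (e, 0)) (at s within X)"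
    if "x + s *\<^sub>R e \<in> S" "R < norm z" for s z X
  proof -
    have "((\<lambda>s. (x + s *\<^sub>R e, z)) has_derivative (\<lambda>u. (u *\<^sub>R e, 0))) (at s within X)"
      by (auto intro!: derivative_eq_intros)
    from has_derivative_compose[OF this, of "\<lambda>(y, z). h y z"] der[OF that]
    have "((\<lambda>s. h (x + s *\<^sub>R e) z) has_derivative (\<lambda>u. A (x + s *\<^sub>R e, z) (u *\<^sub>R e, 0))) (at s within X)"
      by auto
    moreover have "A (x + s *\<^sub>R e, z) (u *\<^sub>R e, 0) = u *\<^sub>R A (x + s *\<^sub>R e, z) (e, 0)" for u
      using linear_scale[OF has_derivative_linear[OF der[OF that]], of u "(e, 0)"] by simp
    ultimately show ?thesis by (simp add: has_vector_derivative_def)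
  qed
  \<comment> \<open>The segment times the circle lies in \<open>K\<close>, so the mean value
    inequality gives the constant \<open>C\<close> uniformly in \<open>z\<close>.\<close>
  have circle: "norm (h (x + s *\<^sub>R e) z - h x z) \<le> C * \<bar>s\<bar>" if s: "\<bar>s\<bar> \<le> r" and z: "norm z = R'" for s z
  proof -
    have "norm (h (x + s *\<^sub>R e) z - h (x + 0 *\<^sub>R e) z) \<le> C * norm (s - 0)"
    proof (rule differentiable_bound[of "{-r..r}"])
      fix q assume q: "q \<in> {-r..r}"
      then have mem: "x + q *\<^sub>R e \<in> cball x \<delta>" by (intro seg) auto
      show "((\<lambda>s. h (x + s *\<^sub>R e) z) has_derivative (\<lambda>u. u *\<^sub>R A (x + q *\<^sub>R e, z) (e, 0))) (at q within {-r..r})"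
        using vd[of q z "{-r..r}"] mem \<delta> R' z by (auto simp: has_vector_derivative_def)
      have "norm (A (x + q *\<^sub>R e, z) (e, 0)) \<le> C"
        by (rule C) (use mem z in \<open>auto simp: K_def\<close>)
      then show "onorm (\<lambda>u. u *\<^sub>R A (x + q *\<^sub>R e, z) (e, 0)) \<le> C"
        by (intro onorm_le) (simp add: mult.commute[of C] mult_left_mono)
    qed (use s r in auto)
    then show ?thesis by simp
  qed
  \<comment> \<open>Since \<open>R\<close> is the same for all points of \<open>S\<close>, the
    difference is itself a series in nonpositive powers for \<open>R < norm z\<close>, and the bound
    on the circle spreads to everything outside it.\<close>
  have outside: "norm (h (x + s *\<^sub>R e) z - h x z) \<le> C * \<bar>s\<bar>" if s: "\<bar>s\<bar> \<le> r" and z: "norm z \<ge> R'" for s z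
  proof (rule maximum_modulus_exterior[where f = "\<lambda>z. h (x + s *\<^sub>R e) z - h x z" and r = R'
        and c = "\<lambda>k. t k (x + s *\<^sub>R e) - t k x", OF S(3)])
    fix z :: complex assume "R < norm z"
    moreover have "x + s *\<^sub>R e \<in> S" using seg[OF s] \<delta> by auto
    ultimately show "(\<lambda>k. (t k (x + s *\<^sub>R e) - t k x) * z powi (- int k)) sums (h (x + s *\<^sub>R e) z - h x z)"
      unfolding left_diff_distrib using S by (intro sums_diff sums) auto
  qed (use R' z circle[OF s] in auto)
  have "norm (A (x, z) (e, 0)) \<le> C" if z: "norm z \<ge> R'" for z
  proof (rule has_vector_derivative_norm_le)
    show "((\<lambda>s. h (x + s *\<^sub>R e) z) has_vector_derivative A (x, z) (e, 0)) (at 0)"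
      using vd[of 0 z UNIV] S z R' by auto
    have "\<forall>\<^sub>F s in at 0. \<bar>s\<bar> \<le> r"
      unfolding eventually_at by (rule exI[of _ r]) (use r in \<open>auto simp: dist_norm\<close>)
    then show "\<forall>\<^sub>F s in at 0. norm (h (x + s *\<^sub>R e) z - h (x + 0 *\<^sub>R e) z) \<le> C * \<bar>s\<bar>"
      by eventually_elim (use outside z in auto)
  qed
  then show ?thesis
    by (intro bigoI[of _ C]) (auto simp: eventually_at_infinity)
qed

text \<open>Writing \<open>h x z = g (inverse z)\<close>, the derivative in \<open>z\<close> is
  \<open>g'\<close> at \<open>inverse z\<close> times \<open>- z powi (-2)\<close>, and
  \<open>g'\<close> is bounded near 0. This gain of two orders is the source of the 2 in
  \<open>N' - 2\<close> and \<open>M' - 2\<close>.\<close>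

lemma spectral_derivative_bounded:
  fixes h :: "'a::real_normed_vector \<Rightarrow> complex \<Rightarrow> complex"
  assumes "R > 0"
    and sums: "\<And>z. R < norm z \<Longrightarrow> (\<lambda>k. t k * z powi (- int k)) sums h x z"
    and der: "\<And>z. R < norm z \<Longrightarrow> ((\<lambda>(y, z). h y z) has_derivative A (x, z)) (at (x, z))"
    and L: "L \<in> O[at_infinity](\<lambda>z. z powi p)"
  shows "(\<lambda>z. A (x, z) (0, L z)) \<in> O[at_infinity](\<lambda>z. z powi (p - 2))"
proof -
  obtain g where g: "g holomorphic_on ball 0 (inverse R)" "\<And>z. R < norm z \<Longrightarrow> h x z = g (inverse z)"
    using exterior_powser_holomorphic[OF assms(1) sums] by blast
  have A: "A (x, z) (0, c) = c * (- (deriv g (inverse z) * z powi (-2)))" if z: "R < norm z" for z c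
  proof -
    have nz: "z \<noteq> 0" using z assms(1) by auto
    have "inverse z \<in> ball 0 (inverse R)"
      using z assms(1) by (auto simp: norm_inverse intro!: less_imp_inverse_less)
    then have "(g has_field_derivative deriv g (inverse z)) (at (inverse z))"
      using g(1) by (intro holomorphic_derivI) auto
    from DERIV_chain2[OF this DERIV_inverse[OF nz]]
    have "((\<lambda>z. g (inverse z)) has_field_derivative - (deriv g (inverse z) * z powi (-2))) (at z)"
      by (simp add: power_int_minus power2_eq_square power_inverse)
    then have "(h x has_field_derivative - (deriv g (inverse z) * z powi (-2))) (at z)"
    proof (rule has_field_derivative_transform_within_open)
      show "open {z::complex. R < norm z}" by (intro open_Collect_less continuous_intros)
    qed (use z g(2) in auto)
    then have 1: "(h x has_derivative (*) (- (deriv g (inverse z) * z powi (-2)))) (at z)"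
      unfolding has_field_derivative_def .
    have "((\<lambda>z. (x, z)) has_derivative (\<lambda>c. (0, c))) (at z)"
      by (auto intro!: derivative_eq_intros)
    from has_derivative_compose[OF this, of "\<lambda>(y, z). h y z"] der[OF z]
    have "(h x has_derivative (\<lambda>c. A (x, z) (0, c))) (at z)" by auto
    \<comment> \<open>The restriction of the joint derivative to the spectral direction and the
      chain rule for \<open>g\<close> differentiate the same function.\<close>
    from has_derivative_unique[OF this 1] show ?thesis by (metis mult.commute)
  qed
  have "isCont (deriv g) 0"
    using holomorphic_on_imp_continuous_on[OF holomorphic_deriv[OF g(1)]] assms(1)
    by (auto simp: continuous_on_eq_continuous_at)
  then have "((\<lambda>z. deriv g (inverse z)) \<longlongrightarrow> deriv g 0) at_infinity"
    by (simp add: isCont_def lim_at_infinity_0 o_def)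
  then have "(\<lambda>z. deriv g (inverse z)) \<in> O[at_infinity](\<lambda>z. z powi 0)"
    by (intro bigoI_tendsto[where c = "deriv g 0"]) auto
  from bigo_powi_mult[OF L bigo_powi_mult[OF this landau_o.big_refl, of "-2"]]
  have "(\<lambda>z. - (L z * (deriv g (inverse z) * z powi (-2)))) \<in> O[at_infinity](\<lambda>z. z powi (p - 2))"
    by simp
  moreover have "\<forall>\<^sub>F z in at_infinity. - (L z * (deriv g (inverse z) * z powi (-2))) = A (x, z) (0, L z)"
    unfolding eventually_at_infinity by (rule exI[of _ "R + 1"]) (auto simp: A)
  ultimately show ?thesis by (rule bigo_transform_eventually)
qed

section \<open>Growth orders of matrices, traces of products and inverses\<close>

definition matrix_bigo :: "(complex \<Rightarrow> complex^'n^'n) \<Rightarrow> int \<Rightarrow> bool" where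
  "matrix_bigo F p \<longleftrightarrow> (\<forall>i j. (\<lambda>z. F z $ i $ j) \<in> O[at_infinity](\<lambda>z. z powi p))"

lemma matrix_expands_imp_bigo:
  "matrix_expands_at_infinity F p C \<Longrightarrow> matrix_bigo F p"
  by (auto simp: matrix_bigo_def matrix_expands_at_infinity_def intro: expands_at_infinity_bigo)

lemma matrix_bigo_mult:
  assumes "matrix_bigo F p" "matrix_bigo G q"
  shows "matrix_bigo (\<lambda>z. F z ** G z) (p + q)"
  using assms unfolding matrix_bigo_def matrix_matrix_mult_def
  by (auto intro!: big_sum_in_bigo bigo_powi_mult)

lemma matrix_bigo_trace:
  "matrix_bigo F p \<Longrightarrow> (\<lambda>z. trace (F z)) \<in> O[at_infinity](\<lambda>z. z powi p)"
  unfolding matrix_bigo_def trace_def by (auto intro!: big_sum_in_bigo)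

text \<open>Identifies the bilinear expressions \<open>f_k\<close> as the coefficients of the trace
  of \<open>U ** V\<close>, by multiplying the expansions entrywise.\<close>

lemma expands_at_infinity_trace_mult:
  assumes "matrix_expands_at_infinity F p C" "matrix_expands_at_infinity G q E"
  shows "expands_at_infinity (\<lambda>z. trace (F z ** G z)) (p + q)
           (\<lambda>k. \<Sum>l=0..k. trace (C l ** E (k - l)))"
proof -
  have "expands_at_infinity (\<lambda>z. \<Sum>i\<in>UNIV. \<Sum>j\<in>UNIV. F z $ i $ j * G z $ j $ i) (p + q)
     (\<lambda>k. \<Sum>i\<in>UNIV. \<Sum>j\<in>UNIV. \<Sum>l\<le>k. C l $ i $ j * E (k - l) $ j $ i)"
    using assms unfolding matrix_expands_at_infinity_def
    by (intro expands_at_infinity_sum expands_at_infinity_mult) auto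
  moreover have "(\<Sum>i\<in>UNIV. \<Sum>j\<in>UNIV. \<Sum>l\<le>k. C l $ i $ j * E (k - l) $ j $ i) =
      (\<Sum>l=0..k. trace (C l ** E (k - l)))" for k
    unfolding trace_def matrix_matrix_mult_def atLeast0AtMost
    \<comment> \<open>The two sides differ by moving the sum over \<open>l\<close> past both index
      sums.\<close>
    by (subst sum.swap[of _ UNIV "{..k}", symmetric], simp, intro sum.cong refl sum.swap)
  ultimately show ?thesis by (simp add: trace_def matrix_matrix_mult_def)
qed

lemma tendsto_det:
  fixes A :: "'b \<Rightarrow> complex^'n^'n"
  assumes "\<And>i j. ((\<lambda>z. A z $ i $ j) \<longlongrightarrow> B $ i $ j) F"
  shows "((\<lambda>z. det (A z)) \<longlongrightarrow> det B) F"
  unfolding det_def by (intro tendsto_intros assms)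

lemma matrix_inv_det_nonzero:
  fixes A :: "'a::field^'n^'n"
  assumes "det A \<noteq> 0"
  shows "A ** matrix_inv A = mat 1" "matrix_inv A ** A = mat 1"
proof -
  have "\<exists>B. A ** B = mat 1 \<and> B ** A = mat 1"
    using assms by (simp add: invertible_det_nz[symmetric] invertible_def)
  from someI_ex[OF this] show "A ** matrix_inv A = mat 1" "matrix_inv A ** A = mat 1"
    unfolding matrix_inv_def by auto
qed

text \<open>Column \<open>m\<close> of the inverse solves a linear system whose right-hand side is
  the \<open>m\<close>-th unit vector. As quotients of determinants, the entries have limits that
  can be read off.\<close>

lemma matrix_inv_cramer:
  fixes A :: "complex^'n^'n"
  assumes "det A \<noteq> 0"
  shows "matrix_inv A $ k $ m =
    det (\<chi> i j. if j = k then (if i = m then 1 else 0) else A $ i $ j) / det A"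
proof -
  have "A ** matrix_inv A = mat 1"
    by (rule matrix_inv_det_nonzero(1)[OF assms])
  then have "A *v (\<chi> k. matrix_inv A $ k $ m) = (\<chi> i. if i = m then 1 else 0)"
    by (simp add: vec_eq_iff matrix_matrix_mult_def matrix_vector_mult_def mat_def)
  from this[unfolded cramer[OF assms]] show ?thesis
    by (simp add: vec_eq_iff cong: if_cong)
qed

text \<open>The determinant tends to \<open>det B\<close>, which is nonzero, so the denominators in
  Cramer's rule stay away from 0 and every entry of the inverse converges.\<close>

lemma matrix_bigo_inverse:
  fixes A :: "complex \<Rightarrow> complex^'n^'n"
  assumes A: "\<And>i j. ((\<lambda>z. A z $ i $ j) \<longlongrightarrow> B $ i $ j) at_infinity" and B: "det B \<noteq> 0"
  shows "matrix_bigo (\<lambda>z. matrix_inv (A z)) 0"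
    and "\<forall>\<^sub>F z in at_infinity. matrix_inv (A z) ** A z = mat 1"
proof -
  have det: "((\<lambda>z. det (A z)) \<longlongrightarrow> det B) at_infinity" by (rule tendsto_det[OF A])
  have ev: "\<forall>\<^sub>F z in at_infinity. det (A z) \<noteq> 0" by (rule tendsto_imp_eventually_ne[OF det B])
  show "\<forall>\<^sub>F z in at_infinity. matrix_inv (A z) ** A z = mat 1"
    using ev by eventually_elim (rule matrix_inv_det_nonzero(2))
  show "matrix_bigo (\<lambda>z. matrix_inv (A z)) 0" unfolding matrix_bigo_def
  proof (intro allI)
    fix k m
    let ?N = "\<lambda>M::complex^'n^'n. \<chi> i j. if j = k then (if i = m then 1 else 0) else M $ i $ j"
    have "((\<lambda>z. det (?N (A z))) \<longlongrightarrow> det (?N B)) at_infinity"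
      by (rule tendsto_det) (simp add: A)
    then have "((\<lambda>z. det (?N (A z)) / det (A z)) \<longlongrightarrow> det (?N B) / det B) at_infinity"
      by (rule tendsto_divide[OF _ det B])
    then have "(\<lambda>z. det (?N (A z)) / det (A z)) \<in> O[at_infinity](\<lambda>z. z powi 0)"
      by (intro bigoI_tendsto[where c = "det (?N B) / det B"]) auto
    moreover have "\<forall>\<^sub>F z in at_infinity. det (?N (A z)) / det (A z) = matrix_inv (A z) $ k $ m"
      using ev by eventually_elim (simp add: matrix_inv_cramer)
    ultimately show "(\<lambda>z. matrix_inv (A z) $ k $ m) \<in> O[at_infinity](\<lambda>z. z powi 0)"
      by (rule bigo_transform_eventually)
  qed
qed

section \<open>The Darboux matrix and the order of its total derivatives\<close>

lemma analytic_at_infinity_onE: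
  assumes "analytic_at_infinity_on \<Omega> D T" "x \<in> \<Omega>"
  obtains S R where "open S" "x \<in> S" "R > 0"
    and "\<And>y z i j. y \<in> S \<Longrightarrow> R < norm z \<Longrightarrow> (\<lambda>k. T k y $ i $ j * z powi (- int k)) sums (D y z $ i $ j)"
    and "continuously_differentiable_on (\<lambda>(y, z). D y z) (S \<times> {z. R < norm z})"
proof -
  from bspec[OF assms(1)[unfolded analytic_at_infinity_on_def] assms(2)]
  show thesis by (elim exE conjE) (rule that; simp)
qed

lemma analytic_at_infinity_expands:
  assumes "analytic_at_infinity_on \<Omega> D T" "x \<in> \<Omega>"
  shows "matrix_expands_at_infinity (D x) 0 (\<lambda>k. T k x)"
proof -
  obtain S R where "x \<in> S" and
    sums: "\<And>y z i j. y \<in> S \<Longrightarrow> R < norm z \<Longrightarrow> (\<lambda>k. T k y $ i $ j * z powi (- int k)) sums (D y z $ i $ j)"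
    by (rule analytic_at_infinity_onE[OF assms]) (rule that; assumption)
  show ?thesis
    unfolding matrix_expands_at_infinity_def expands_at_infinity_def eventually_at_infinity
    using sums[OF \<open>x \<in> S\<close>] by (auto intro!: exI[of _ "R + 1"])
qed

text \<open>By linearity the derivative in the direction \<open>(e, L x z)\<close> splits into a
  part along \<open>(e, 0)\<close>, which is bounded, and a part along \<open>(0, L x z)\<close>, of
  order \<open>p - 2\<close>; the maximum covers both.\<close>

lemma total_derivative_bigo:
  assumes "analytic_at_infinity_on \<Omega> D T" "x \<in> \<Omega>"
    and L: "L x \<in> O[at_infinity](\<lambda>z. z powi p)"
  shows "matrix_bigo (total_derivative e L D x) (max 0 (p - 2))"
proof -
  obtain S R where S: "open S" "x \<in> S" "R > 0" and
    sums: "\<And>y z i j. y \<in> S \<Longrightarrow> R < norm z \<Longrightarrow> (\<lambda>k. T k y $ i $ j * z powi (- int k)) sums (D y z $ i $ j)"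
    and C1: "continuously_differentiable_on (\<lambda>(y, z). D y z) (S \<times> {z. R < norm z})"
    by (rule analytic_at_infinity_onE[OF assms(1,2)]) (rule that; assumption)
  define A where "A q = frechet_derivative (\<lambda>(y, z). D y z) (at q)" for q
  have der: "((\<lambda>(y, z). D y z) has_derivative A (y, z)) (at (y, z))" if "y \<in> S" "R < norm z" for y z
    using C1 that by (auto simp: continuously_differentiable_on_def A_def frechet_derivative_works[symmetric])
  have der': "((\<lambda>(y, z). D y z $ i $ j) has_derivative (\<lambda>v. A (y, z) v $ i $ j)) (at (y, z))"
    if "y \<in> S" "R < norm z" for y z i j
    using bounded_linear.has_derivative[OF bounded_linear_vec_nth
        bounded_linear.has_derivative[OF bounded_linear_vec_nth der[OF that]], of i j]
    by (simp add: case_prod_unfold)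
  have cont: "continuous_on (S \<times> {z. R < norm z}) (\<lambda>q. A q (e, 0) $ i $ j)" for i j
    using C1 unfolding continuously_differentiable_on_def A_def by (intro continuous_intros) blast
  show ?thesis unfolding matrix_bigo_def
  proof (intro allI)
    fix i j
    have "(\<lambda>z. A (x, z) (e, 0) $ i $ j) \<in> O[at_infinity](\<lambda>_. 1)"
      by (rule parameter_derivative_bounded[where h = "\<lambda>y z. D y z $ i $ j" and A = "\<lambda>q v. A q v $ i $ j",
          OF S sums der' cont])
    then have 1: "(\<lambda>z. A (x, z) (e, 0) $ i $ j) \<in> O[at_infinity](\<lambda>z. z powi max 0 (p - 2))"
      using bigo_powi_mono[of "\<lambda>z. A (x, z) (e, 0) $ i $ j" 0 "max 0 (p - 2)"] by simp
    have "(\<lambda>z. A (x, z) (0, L x z) $ i $ j) \<in> O[at_infinity](\<lambda>z. z powi (p - 2))"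
      by (rule spectral_derivative_bounded[where h = "\<lambda>y z. D y z $ i $ j" and A = "\<lambda>q v. A q v $ i $ j",
          OF S(3) sums[OF S(2)] der'[OF S(2)] L])
    then have 2: "(\<lambda>z. A (x, z) (0, L x z) $ i $ j) \<in> O[at_infinity](\<lambda>z. z powi max 0 (p - 2))"
      by (rule bigo_powi_mono) auto
    have "\<forall>\<^sub>F z in at_infinity. A (x, z) (e, 0) $ i $ j + A (x, z) (0, L x z) $ i $ j =
        total_derivative e L D x z $ i $ j"
      unfolding eventually_at_infinity
    proof (intro exI allI impI)
      fix z :: complex assume "R + 1 \<le> norm z"
      then have "linear (A (x, z))" by (intro has_derivative_linear[OF der] S(2)) auto
      from linear_add[OF this, of "(e, 0)" "(0, L x z)"]
      show "A (x, z) (e, 0) $ i $ j + A (x, z) (0, L x z) $ i $ j = total_derivative e L D x z $ i $ j"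
        by (simp add: total_derivative_def A_def)
    qed
    with sum_in_bigo(1)[OF 1 2]
    show "(\<lambda>z. total_derivative e L D x z $ i $ j) \<in> O[at_infinity](\<lambda>z. z powi max 0 (p - 2))"
      by (rule bigo_transform_eventually)
  qed
qed

section \<open>The trace identity for the transformation and the invariance of the
  coefficients\<close>

lemma matrix_add_rdistrib: "(B + C) ** A = B ** A + C ** A"
  by (vector matrix_matrix_mult_def sum.distrib[symmetric] distrib_right)

text \<open>Of the four products, \<open>D ** U ** W ** D ** V ** W\<close> collapses to a conjugate
  of \<open>U ** V\<close>. In the mixed terms an inner \<open>W ** D\<close> cancels or an outer
  \<open>D\<close>, \<open>W\<close> disappears under the trace.\<close>

lemma trace_gauge_mult:
  fixes D W :: "'a::comm_ring_1^'n^'n"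
  assumes "W ** D = mat 1"
  shows "trace ((X ** W + D ** U ** W) ** (Y ** W + D ** V ** W)) =
    trace (U ** V) + (trace (X ** V ** W) + trace (U ** W ** Y) + trace (X ** W ** Y ** W))"
proof -
  have cancel: "P ** W ** D = P" for P :: "'a^'n^'n"
    using assms by (simp add: matrix_mul_assoc[symmetric])
  have conj: "trace (D ** P ** W) = trace P" for P :: "'a^'n^'n"
    using assms by (simp add: matrix_mul_assoc trace_mul_sym[of "D ** P"])
  have "(X ** W + D ** U ** W) ** (Y ** W + D ** V ** W) =
      D ** (U ** V) ** W + (X ** V ** W + D ** (U ** W ** Y) ** W + X ** W ** Y ** W)"
    by (simp add: matrix_add_ldistrib matrix_add_rdistrib matrix_mul_assoc cancel)
  then show ?thesis by (simp add: trace_add conj)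
qed

theorem proposition8p3:
  fixes \<Omega> :: "point set"
    and N M N' M' :: int
    and U V D :: "point \<Rightarrow> complex \<Rightarrow> complex^'n^'n"
    and lam1 lam2 :: "point \<Rightarrow> complex \<Rightarrow> complex"
    and u v T u' v' :: "nat \<Rightarrow> point \<Rightarrow> complex^'n^'n"
    and a b :: "nat \<Rightarrow> point \<Rightarrow> complex"
  assumes "open \<Omega>"
    and "N > 0" and "M > 0"
    and "\<And>x. x \<in> \<Omega> \<Longrightarrow> matrix_expands_at_infinity (U x) N (\<lambda>k. u k x)"
    and "\<And>x. x \<in> \<Omega> \<Longrightarrow> matrix_expands_at_infinity (V x) M (\<lambda>k. v k x)"
    and "\<And>x. x \<in> \<Omega> \<Longrightarrow> expands_at_infinity (lam1 x) N' (\<lambda>k. a k x)"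
    and "\<And>x. x \<in> \<Omega> \<Longrightarrow> expands_at_infinity (lam2 x) M' (\<lambda>k. b k x)"
    and "analytic_at_infinity_on \<Omega> D T"
    and "\<And>x. x \<in> \<Omega> \<Longrightarrow>
           matrix_expands_at_infinity (darboux_transform (1, 0) lam1 D U x) N (\<lambda>k. u' k x)"
    and "\<And>x. x \<in> \<Omega> \<Longrightarrow>
           matrix_expands_at_infinity (darboux_transform (0, 1) lam2 D V x) M (\<lambda>k. v' k x)"
    and "\<And>x. x \<in> \<Omega> \<Longrightarrow> det (T 0 x) \<noteq> 0"
  shows "\<forall>x\<in>\<Omega>. \<forall>k::nat. int k \<le> k_max2 N M N' M' \<longrightarrow>
           bilinear_form u' v' k x = bilinear_form u v k x"
proof (intro ballI allI impI)
  fix x k assume x: "x \<in> \<Omega>" and k: "int k \<le> k_max2 N M N' M'"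
  note U = assms(4)[OF x] and V = assms(5)[OF x]
  note U' = assms(9)[OF x] and V' = assms(10)[OF x]
  define W where "W z = matrix_inv (D x z)" for z
  define X where "X = total_derivative (1, 0) lam1 D x"
  define Y where "Y = total_derivative (0, 1) lam2 D x"
  define p where "p = max 0 (N' - 2)"
  define q where "q = max 0 (M' - 2)"
  \<comment> \<open>The largest order among the three error terms, since \<open>W\<close> has order
    0.\<close>
  define r where "r = max (p + M) (max (N + q) (p + q))"
  let ?E = "\<lambda>z. trace (X z ** V x z ** W z) + trace (U x z ** W z ** Y z) +
    trace (X z ** W z ** Y z ** W z)"
  let ?tr = "\<lambda>z. trace (U x z ** V x z)"
  let ?tr' = "\<lambda>z. trace (darboux_transform (1, 0) lam1 D U x z ** darboux_transform (0, 1) lam2 D V x z)"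
  have "((\<lambda>z. D x z $ i $ j) \<longlongrightarrow> T 0 x $ i $ j) at_infinity" for i j
    using analytic_at_infinity_expands[OF assms(8) x] expands_at_infinity_lead[of "\<lambda>z. D x z $ i $ j" 0]
    by (auto simp: matrix_expands_at_infinity_def)
  note W = matrix_bigo_inverse[OF this assms(11)[OF x], folded W_def]
  have X: "matrix_bigo X p"
    unfolding X_def p_def by (rule total_derivative_bigo[where L = lam1, OF assms(8) x expands_at_infinity_bigo[OF assms(6)[OF x]]])
  have Y: "matrix_bigo Y q"
    unfolding Y_def q_def by (rule total_derivative_bigo[where L = lam2, OF assms(8) x expands_at_infinity_bigo[OF assms(7)[OF x]]])
  have "(\<lambda>z. trace (X z ** V x z ** W z)) \<in> O[at_infinity](\<lambda>z. z powi (p + M + 0))"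
    by (intro matrix_bigo_trace matrix_bigo_mult X W(1) matrix_expands_imp_bigo[OF V])
  moreover have "(\<lambda>z. trace (U x z ** W z ** Y z)) \<in> O[at_infinity](\<lambda>z. z powi (N + 0 + q))"
    by (intro matrix_bigo_trace matrix_bigo_mult Y W(1) matrix_expands_imp_bigo[OF U])
  moreover have "(\<lambda>z. trace (X z ** W z ** Y z ** W z)) \<in> O[at_infinity](\<lambda>z. z powi (p + 0 + q + 0))"
    by (intro matrix_bigo_trace matrix_bigo_mult X Y W(1))
  ultimately have E: "?E \<in> O[at_infinity](\<lambda>z. z powi r)"
    by (intro sum_in_bigo; elim bigo_powi_mono) (auto simp: r_def)
  have "\<forall>\<^sub>F z in at_infinity. ?E z = ?tr' z - ?tr z"
    using W(2)
  proof eventually_elim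
    case (elim z)
    from trace_gauge_mult[OF elim, of "X z" "U x z" "Y z" "V x z"]
    show ?case by (simp add: darboux_transform_def X_def Y_def W_def)
  qed
  with E have diff: "(\<lambda>z. ?tr' z - ?tr z) \<in> O[at_infinity](\<lambda>z. z powi r)"
    by (rule bigo_transform_eventually)
  \<comment> \<open>The entries of \<open>k_max1\<close> are those of \<open>N - p\<close> and
    \<open>M - q\<close> written as minima, which handle the first two error terms;
    \<open>k_mn\<close> is \<open>N + M - p - q - 1\<close>, for the third. The \<open>-1\<close> in
    both turns the strict inequality into a weak one.\<close>
  have "r < N + M - int k"
    using k by (auto simp: r_def p_def q_def k_max2_def k_max1_def k_mn_def)
  \<comment> \<open>The coefficient of index \<open>k\<close> in the difference of the traces
    belongs to a power above \<open>r\<close>, so it vanishes.\<close>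
  from expands_at_infinity_coeff_zero[OF expands_at_infinity_diff[OF
      expands_at_infinity_trace_mult[OF U' V'] expands_at_infinity_trace_mult[OF U V]] diff this]
  show "bilinear_form u' v' k x = bilinear_form u v k x" by (simp add: bilinear_form_def)
qed

end
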